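(* Let $s\in(0,1)$ and let $\varphi:\mathbb{R}\to\mathbb{R}$ be a bounded, locally $C^{\bar\gamma}$ function for $s<\bar\gamma\le 1$. Let $U:[0,\infty)\times\mathbb{R}\to\mathbb{R}$ be a solution of the problem $$\begin{cases}\dfrac{\partial U}{\partial t}(x,t)=\dfrac{1-2s}{x}\dfrac{\partial U}{\partial x}(x,t)+\dfrac{\partial^2 U}{\partial x^2}(x,t), & (x,t)\in(0,\infty)\times\mathbb{R},\\[2mm] U(0,t)=\varphi(t), & t\in\mathbb{R},\\ \lim_{x\to\infty}U(x,t)=0. & \end{cases}$$ Then $U$ defines the extension operator for $\varphi$, such that $$\mathbf{D}^s\varphi(t)=-\lim_{x\to0^+}c_s\,x^{-2s}\bigl(U(x,t)-\varphi(t)\bigr),$$ where $c_s=4^s\Gamma(s)$.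
   Context: For $s\in(0,1)$ the (left) Marchaud fractional derivative, with the multiplicative constant neglected, is $$\mathbf{D}^s\varphi(t):=\int_0^\infty\frac{\varphi(t)-\varphi(t-\tau)}{\tau^{s+1}}\,d\tau .$$ $\Gamma$ is Euler's Gamma function. "Locally $C^{\bar\gamma}$" means locally Hölder continuous with exponent $\bar\gamma$ (locally Lipschitz when $\bar\gamma=1$). That $U$ "defines the extension operator for $\varphi$" means that $U$ extends $\varphi$ from the line $x=0$ to the half-plane $[0,\infty)\times\mathbb{R}$ and that $\mathbf{D}^s\varphi$ is recovered from $U$ by the displayed limit.
   Formalization: The solution U is additionally assumed bounded on [0,∞)×ℝ; without this the claim fails, e.g. s=1/2, φ=0, U(x,t)=∫_1^2 exp(-k²t) sin(kx) dk. A solution is taken to be continuous up to x=0. *)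

theory Defs
  imports "HOL-Analysis.Analysis"
begin

definition marchaud_integrand :: "real \<Rightarrow> (real \<Rightarrow> real) \<Rightarrow> real \<Rightarrow> real \<Rightarrow> real" where
  "marchaud_integrand s \<phi> t \<tau> = (\<phi> t - \<phi> (t - \<tau>)) / \<tau> powr (s + 1)"

text \<open>The Bochner integral is \<open>0\<close> when the integrand is not integrable, so statements about
  the value of the derivative should be accompanied by integrability of the integrand.\<close>

definition marchaud_deriv :: "real \<Rightarrow> (real \<Rightarrow> real) \<Rightarrow> real \<Rightarrow> real" where
  "marchaud_deriv s \<phi> t = (LBINT \<tau>:{0<..}. marchaud_integrand s \<phi> t \<tau>)"

definition locally_hoelder :: "real \<Rightarrow> (real \<Rightarrow> real) \<Rightarrow> bool" where
  "locally_hoelder \<gamma> \<phi> \<longleftrightarrow>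
     (\<forall>K. compact K \<longrightarrow>
        (\<exists>C. \<forall>x\<in>K. \<forall>y\<in>K. \<bar>\<phi> x - \<phi> y\<bar> \<le> C * \<bar>x - y\<bar> powr \<gamma>))"

text \<open>Classical solutions: the derivatives in the equation exist pointwise for \<open>x > 0\<close>, and \<open>U\<close>
  is continuous up to \<open>x = 0\<close>, so that the boundary values are attained (otherwise the condition on
  the line \<open>x = 0\<close> would be unrelated to the equation). Values of \<open>U\<close> at \<open>x < 0\<close> are irrelevant.\<close>

definition extension_solution :: "real \<Rightarrow> (real \<Rightarrow> real) \<Rightarrow> (real \<Rightarrow> real \<Rightarrow> real) \<Rightarrow> bool" where
  "extension_solution s \<phi> U \<longleftrightarrow>
     continuous_on ({0..} \<times> UNIV) (\<lambda>(x, t). U x t) \<and>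
     (\<forall>x>0. \<forall>t.
        (\<lambda>\<tau>. U x \<tau>) differentiable (at t) \<and>
        (\<lambda>\<xi>. U \<xi> t) differentiable (at x) \<and>
        deriv (\<lambda>\<xi>. U \<xi> t) differentiable (at x) \<and>
        deriv (\<lambda>\<tau>. U x \<tau>) t =
          (1 - 2 * s) / x * deriv (\<lambda>\<xi>. U \<xi> t) x + deriv (deriv (\<lambda>\<xi>. U \<xi> t)) x) \<and>
     (\<forall>t. U 0 t = \<phi> t) \<and>
     (\<forall>t. ((\<lambda>x. U x t) \<longlongrightarrow> 0) at_top)"

text \<open>\<open>U\<close> extends \<open>\<phi>\<close> from the line \<open>x = 0\<close>, and the (convergent) Marchaud derivative of \<open>\<phi>\<close> is
  recovered from \<open>U\<close>.\<close>

definition defines_extension_operator ::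
  "real \<Rightarrow> (real \<Rightarrow> real) \<Rightarrow> (real \<Rightarrow> real \<Rightarrow> real) \<Rightarrow> bool" where
  "defines_extension_operator s \<phi> U \<longleftrightarrow>
     (\<forall>t. U 0 t = \<phi> t) \<and>
     (\<forall>t. set_integrable lborel {0<..} (marchaud_integrand s \<phi> t) \<and>
          ((\<lambda>x. - (4 powr s * Gamma s * x powr (- 2 * s) * (U x t - \<phi> t)))
             \<longlongrightarrow> marchaud_deriv s \<phi> t) (at_right 0))"

end

theory Submission
  imports Defs "HOL-Real_Asymp.Real_Asymp" "HOL-Probability.Sinc_Integral"
begin

text \<open>
  Substituting \<open>\<tau> = x\<^sup>2 / (4 u)\<close> in the Gamma integral shows that
  \<open>x powr (2 s) * exp (- x\<^sup>2 / (4 \<tau>)) * \<tau> powr (- s - 1) / (4 powr s * Gamma s)\<close>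
  is a probability density in \<open>\<tau> > 0\<close>. Averaging \<open>\<phi> (t - \<tau>)\<close> against it gives a bounded solution
  \<open>V\<close> with boundary values \<open>\<phi>\<close>. A bounded solution is determined by its boundary
  values: the difference \<open>W = U - V\<close> vanishes at \<open>x = 0\<close> and is bounded by some \<open>M\<close>, so on
  \<open>[0, R] \<times> [t0, T]\<close> the maximum principle compares it with \<open>M (x / R) powr (2 s)\<close> plus a term decaying
  exponentially in \<open>T - t0\<close>; letting first \<open>t0 \<rightarrow> -\<infinity>\<close> and then \<open>R \<rightarrow> \<infinity>\<close> gives \<open>W = 0\<close>. Finally,
  \<open>- 4 powr s * Gamma s * x powr (- 2 s) * (V - \<phi>)\<close> is the Marchaud integral with the additional
  factor \<open>exp (- x\<^sup>2 / (4 \<tau>))\<close> in the integrand, and dominated convergence applies as \<open>x \<rightarrow> 0\<close>.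
\<close>

section \<open>Maximum principle and uniqueness of bounded solutions\<close>

text \<open>A positive second derivative would make the first derivative, which is zero at
  \<open>x\<close>, positive just to the right of \<open>x\<close>, so \<open>f\<close> would rise
  above its maximum. The second derivative is required at the single point \<open>x\<close>
  only.\<close>

lemma second_deriv_nonpos_at_local_max:
  fixes f f' :: "real \<Rightarrow> real"
  assumes "a < x" "x < b"
    and f: "\<And>y. a < y \<Longrightarrow> y < b \<Longrightarrow> (f has_real_derivative f' y) (at y)"
    and f': "(f' has_real_derivative f'') (at x)"
    and max: "\<And>y. a < y \<Longrightarrow> y < b \<Longrightarrow> f y \<le> f x"
  shows "f' x = 0" "f'' \<le> 0"
proof -
  show 0: "f' x = 0"
  proof (rule DERIV_local_max)
    show "(f has_real_derivative f' x) (at x)" using f assms(1,2) by blast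
    show "0 < min (x - a) (b - x)" using assms(1,2) by simp
    show "\<forall>y. \<bar>x - y\<bar> < min (x - a) (b - x) \<longrightarrow> f y \<le> f x"
      using max by (auto simp: abs_less_iff)
  qed
  show "f'' \<le> 0"
  proof (rule ccontr)
    assume "\<not> f'' \<le> 0"
    then obtain d where d: "d > 0" "\<And>h. 0 < h \<Longrightarrow> h < d \<Longrightarrow> f' x < f' (x + h)"
      using DERIV_pos_inc_right[OF f'] by auto
    define h where "h = min d (b - x) / 2"
    have h: "0 < h" "h < d" "x + h < b" using d(1) assms(2) by (auto simp: h_def min_def field_simps)
    have "f x < f (x + h)"
    proof (rule DERIV_pos_imp_increasing_open[where f=f])
      fix y assume y: "x < y" "y < x + h"
      show "\<exists>z. (f has_real_derivative z) (at y) \<and> 0 < z"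
        using f[of y] d(2)[of "y - x"] y h assms(1) 0 by auto
    next
      show "continuous_on {x..x + h} f"
        using f h assms(1) by (intro DERIV_atLeastAtMost_imp_continuous_on) (meson less_le_trans le_less_trans)
    qed (use h in auto)
    then show False using max[of "x + h"] h assms(1) by simp
  qed
qed

text \<open>At a maximum off the left, right and bottom sides one has \<open>Wx = 0\<close>,
  \<open>Wxx \<le> 0\<close> and \<open>Wt \<ge> 0\<close>, against the strict inequality. The
  coefficient \<open>b\<close> may be arbitrary because it is multiplied by \<open>Wx = 0\<close>,
  so the singular drift at \<open>x = 0\<close> does no harm.\<close>

lemma parabolic_max_principle:
  fixes W Wx Wxx Wt b :: "real \<Rightarrow> real \<Rightarrow> real"
  assumes "0 < R" "l \<le> T"
    and cont: "continuous_on ({0..R} \<times> {l..T}) (\<lambda>(x, t). W x t)"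
    and Wx: "\<And>x t. 0 < x \<Longrightarrow> x < R \<Longrightarrow> ((\<lambda>\<xi>. W \<xi> t) has_real_derivative Wx x t) (at x)"
    and Wxx: "\<And>x t. 0 < x \<Longrightarrow> x < R \<Longrightarrow> ((\<lambda>\<xi>. Wx \<xi> t) has_real_derivative Wxx x t) (at x)"
    and Wt: "\<And>x t. 0 < x \<Longrightarrow> x < R \<Longrightarrow> ((\<lambda>\<tau>. W x \<tau>) has_real_derivative Wt x t) (at t)"
    and subsol: "\<And>x t. 0 < x \<Longrightarrow> x < R \<Longrightarrow> l < t \<Longrightarrow> t \<le> T \<Longrightarrow> Wt x t < b x t * Wx x t + Wxx x t"
    and left: "\<And>t. l \<le> t \<Longrightarrow> t \<le> T \<Longrightarrow> W 0 t \<le> 0"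
    and right: "\<And>t. l \<le> t \<Longrightarrow> t \<le> T \<Longrightarrow> W R t \<le> 0"
    and bottom: "\<And>x. 0 \<le> x \<Longrightarrow> x \<le> R \<Longrightarrow> W x l \<le> 0"
    and x: "0 \<le> x" "x \<le> R" and t: "l \<le> t" "t \<le> T"
  shows "W x t \<le> 0"
proof -
  have "compact ({0..R} \<times> {l..T})" "{0..R} \<times> {l..T} \<noteq> {}"
    using assms(1,2) by (auto intro: compact_Times)
  from continuous_attains_sup[OF this cont] obtain y r where
    yr: "y \<in> {0..R}" "r \<in> {l..T}"
    and max: "\<And>x t. x \<in> {0..R} \<Longrightarrow> t \<in> {l..T} \<Longrightarrow> W x t \<le> W y r" by force
  have "y = 0 \<or> y = R \<or> r = l"
  proof (rule ccontr)
    assume "\<not> ?thesis"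
    then have int: "0 < y" "y < R" "l < r" "r \<le> T" using yr by auto
    have 1: "Wx y r = 0" "Wxx y r \<le> 0"
      using second_deriv_nonpos_at_local_max[of 0 y R "\<lambda>\<xi>. W \<xi> r" "\<lambda>\<xi>. Wx \<xi> r", OF int(1,2) Wx Wxx]
        int max by auto
    \<comment> \<open>Only earlier times are compared, so the argument also covers the top side
      \<open>r = T\<close>.\<close>
    have 2: "Wt y r \<ge> 0"
    proof (rule ccontr)
      assume "\<not> ?thesis"
      then obtain d where d: "d > 0" "\<And>h. 0 < h \<Longrightarrow> h < d \<Longrightarrow> W y r < W y (r - h)"
        using DERIV_neg_dec_left[OF Wt[OF int(1,2), of r]] by auto
      have "W y r < W y (r - min d (r - l) / 2)" using d int by (intro d(2)) auto
      then show False using max[of y "r - min d (r - l) / 2"] int d(1)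
        by (auto simp: min_def field_simps split: if_splits)
    qed
    show False using subsol[OF int] 1 2 by simp
  qed
  then have "W y r \<le> 0" using yr left right bottom by auto
  then show ?thesis using max[of x t] x t by simp
qed

text \<open>There is no initial time: the bottom side of the rectangle recedes to minus infinity,
  and the exponential decay of the barrier erases what is known there, namely the bound
  \<open>M\<close>. The estimate is one-sided, to be applied to a difference of solutions and to its
  negative.\<close>

lemma bounded_ancient_solution_nonpos:
  fixes W Wx Wxx Wt :: "real \<Rightarrow> real \<Rightarrow> real"
  assumes s: "0 < s" "s < 1"
    and cont: "continuous_on ({0..} \<times> UNIV) (\<lambda>(x, t). W x t)"
    and Wx: "\<And>x t. 0 < x \<Longrightarrow> ((\<lambda>\<xi>. W \<xi> t) has_real_derivative Wx x t) (at x)"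
    and Wxx: "\<And>x t. 0 < x \<Longrightarrow> ((\<lambda>\<xi>. Wx \<xi> t) has_real_derivative Wxx x t) (at x)"
    and Wt: "\<And>x t. 0 < x \<Longrightarrow> ((\<lambda>\<tau>. W x \<tau>) has_real_derivative Wt x t) (at t)"
    and pde: "\<And>x t. 0 < x \<Longrightarrow> Wt x t = (1 - 2 * s) / x * Wx x t + Wxx x t"
    and zero: "\<And>t. W 0 t = 0"
    and bound: "\<And>x t. 0 \<le> x \<Longrightarrow> W x t \<le> M"
    and "0 < x"
  shows "W x T \<le> 0"
proof -
  have M: "0 \<le> M" using zero[of 0] bound[of 0 0] by simp
  \<comment> \<open>\<open>M\<close> may be zero; a strictly positive factor is needed for the
    barrier to be a strict supersolution.\<close>
  define M1 where "M1 = M + 1"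
  have M1: "0 < M1" "M \<le> M1" using M by (auto simp: M1_def)
  have est: "W x T \<le> M1 * (x / R) powr (2 * s)
      + M1 * exp (- ((2 - 2 * s) / (R\<^sup>2 + 1)) * (T - t0)) * (R\<^sup>2 + 1 - x\<^sup>2)"
    if R: "x < R" and t0: "t0 \<le> T" for R t0
  proof -
    define l where "l = (2 - 2 * s) / (R\<^sup>2 + 1)"
    have R2: "0 < R\<^sup>2 + 1" by (simp add: add_nonneg_pos)
    have l: "l * (R\<^sup>2 + 1) = 2 - 2 * s" "0 < l" using R2 s by (auto simp: l_def)
    have R0: "0 < R" using R \<open>0 < x\<close> by simp
    \<comment> \<open>The first term of \<open>B\<close> is a stationary solution; \<open>l\<close> is half of the largest decay rate for
      which the second term is still a supersolution, which makes \<open>B\<close> a strict one.\<close>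
    define B where "B = (\<lambda>x t. M1 * (x / R) powr (2 * s) + M1 * exp (- l * (t - t0)) * (R\<^sup>2 + 1 - x\<^sup>2))"
    define Bx where "Bx = (\<lambda>x t. M1 * (2 * s / x) * (x / R) powr (2 * s) - 2 * M1 * exp (- l * (t - t0)) * x)"
    define Bxx where "Bxx = (\<lambda>x t. M1 * (2 * s * (2 * s - 1) / x\<^sup>2) * (x / R) powr (2 * s) - 2 * M1 * exp (- l * (t - t0)))"
    define Bt where "Bt = (\<lambda>x t. - l * M1 * exp (- l * (t - t0)) * (R\<^sup>2 + 1 - x\<^sup>2))"
    have pw: "(x / R) powr (2 * s - 1) = R / x * (x / R) powr (2 * s)" if "0 < x" for x
      using that R0 by (simp add: powr_diff)
    have "W x T - B x T \<le> 0"
    proof (rule parabolic_max_principle[where W="\<lambda>x t. W x t - B x t" and b="\<lambda>x t. (1 - 2 * s) / x" and R=R and l=t0 and T=T and Wx="\<lambda>x t. Wx x t - Bx x t"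
            and Wxx="\<lambda>x t. Wxx x t - Bxx x t" and Wt="\<lambda>x t. Wt x t - Bt x t"])
      have "continuous_on ({0..R} \<times> {t0..T}) (\<lambda>z. B (fst z) (snd z))"
        unfolding B_def using s R0
        by (intro continuous_intros continuous_on_powr') auto
      moreover have "continuous_on ({0..R} \<times> {t0..T}) (\<lambda>z. W (fst z) (snd z))"
        using cont unfolding case_prod_unfold by (rule continuous_on_subset) auto
      ultimately show "continuous_on ({0..R} \<times> {t0..T}) (\<lambda>(x, t). W x t - B x t)"
        by (simp add: case_prod_unfold continuous_on_diff)
    next
      fix x t :: real assume x: "0 < x" "x < R"
      show "((\<lambda>\<xi>. W \<xi> t - B \<xi> t) has_real_derivative Wx x t - Bx x t) (at x)"
        unfolding B_def Bx_def using x by (auto intro!: derivative_eq_intros Wx simp: pw)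
      show "((\<lambda>\<xi>. Wx \<xi> t - Bx \<xi> t) has_real_derivative Wxx x t - Bxx x t) (at x)"
        unfolding Bx_def Bxx_def using x R0
        by (auto intro!: derivative_eq_intros Wxx simp: pw pw[unfolded mult.commute[of 2 s]] field_simps power2_eq_square)
      show "((\<lambda>\<tau>. W x \<tau> - B x \<tau>) has_real_derivative Wt x t - Bt x t) (at t)"
        unfolding B_def Bt_def using x
        by (auto intro!: derivative_eq_intros Wt)
      assume t: "t0 < t" "t \<le> T"
      define e where "e = M1 * exp (- l * (t - t0))"
      have e: "0 < e" using M1 by (simp add: e_def)
      have "Bt x t = - (2 - 2 * s) * e + e * (l * x\<^sup>2)"
        unfolding Bt_def e_def l(1)[symmetric] by (simp add: algebra_simps)
      then have 1: "Bt x t \<ge> - (2 - 2 * s) * e" using e l by simp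
      \<comment> \<open>The power terms cancel, being stationary. The rest comes from applying the
        operator to \<open>- x\<^sup>2\<close> and is twice the bound in \<open>1\<close>, which
        leaves a strict gap.\<close>
      have 2: "(1 - 2 * s) / x * Bx x t + Bxx x t = - (4 - 4 * s) * e"
        unfolding Bx_def Bxx_def e_def using x by (simp add: field_simps power2_eq_square)
      have "(2 - 2 * s) * e > 0" using e s by simp
      then have 3: "Bt x t > (1 - 2 * s) / x * Bx x t + Bxx x t" using 1 2 by (simp add: algebra_simps)
      then show "Wt x t - Bt x t < (1 - 2 * s) / x * (Wx x t - Bx x t) + (Wxx x t - Bxx x t)"
        unfolding right_diff_distrib using pde[OF x(1), of t] by linarith
    next
      fix t assume "t0 \<le> t" "t \<le> T"
      show "W 0 t - B 0 t \<le> 0" using zero M1 R2 by (simp add: B_def)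
      have "M1 \<le> B R t" using R0 M1 by (simp add: B_def)
      then show "W R t - B R t \<le> 0" using bound[of R t] R0 M1 by simp
    next
      fix x assume x: "0 \<le> x" "x \<le> R"
      \<comment> \<open>The summand 1 in \<open>R\<^sup>2 + 1\<close> keeps the second term of the
        barrier at least \<open>M1\<close> on the whole bottom side, including the corner
        \<open>x = R\<close>.\<close>
      then have "1 \<le> R\<^sup>2 + 1 - x\<^sup>2" by simp
      then have "M1 * 1 \<le> M1 * (R\<^sup>2 + 1 - x\<^sup>2)" using M1 by (intro mult_left_mono) auto
      then have "M1 \<le> B x t0" using M1 unfolding B_def by (simp add: add_increasing)
      then show "W x t0 - B x t0 \<le> 0" using bound[of x t0] x M1 by simp
    qed (use R0 R \<open>0 < x\<close> t0 in auto)
    then show ?thesis by (simp add: B_def l_def)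
  qed
  have est2: "W x T \<le> M1 * (x / R) powr (2 * s)" if R: "x < R" for R
  proof -
    define l where "l = (2 - 2 * s) / (R\<^sup>2 + 1)"
    have R2: "0 < R\<^sup>2 + 1" by (simp add: add_nonneg_pos)
    have l: "0 < l" using R2 s by (auto simp: l_def)
    have "((\<lambda>t0. M1 * (x / R) powr (2 * s) + M1 * exp (- l * (T - t0)) * (R\<^sup>2 + 1 - x\<^sup>2))
      \<longlongrightarrow> M1 * (x / R) powr (2 * s) + M1 * 0 * (R\<^sup>2 + 1 - x\<^sup>2)) at_bot"
    proof (intro tendsto_intros filterlim_compose[OF exp_at_bot])
      show "filterlim (\<lambda>t0. - l * (T - t0)) at_bot at_bot"
        using l by real_asymp
    qed
    moreover have "\<forall>\<^sub>F t0 in at_bot. W x T \<le> M1 * (x / R) powr (2 * s) + M1 * exp (- l * (T - t0)) * (R\<^sup>2 + 1 - x\<^sup>2)"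
      using est[OF R] unfolding l_def eventually_at_bot_linorder by auto
    ultimately show ?thesis by (intro tendsto_lowerbound) auto
  qed
  have "((\<lambda>R. M1 * (x / R) powr (2 * s)) \<longlongrightarrow> 0) at_top"
    using s \<open>0 < x\<close> by real_asymp
  moreover have "\<forall>\<^sub>F R in at_top. W x T \<le> M1 * (x / R) powr (2 * s)"
    using est2 unfolding eventually_at_top_dense by auto
  ultimately show ?thesis by (intro tendsto_lowerbound) auto
qed

section \<open>The inverse Gamma kernel\<close>

text \<open>Differentiation under the integral sign. The mean value inequality bounds the difference
  quotients by \<open>w\<close>, so dominated convergence applies along every sequence tending to
  \<open>x\<close>.\<close>

lemma has_real_derivative_integral:
  fixes f f' :: "real \<Rightarrow> 'a \<Rightarrow> real" and w :: "'a \<Rightarrow> real"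
  assumes "0 < e"
    and int: "\<And>y. \<bar>y - x\<bar> < e \<Longrightarrow> integrable M (f y)"
    and f': "\<And>y r. \<bar>y - x\<bar> < e \<Longrightarrow> ((\<lambda>y. f y r) has_real_derivative f' y r) (at y)"
    and meas: "f' x \<in> borel_measurable M"
    and bound: "\<And>y r. \<bar>y - x\<bar> < e \<Longrightarrow> \<bar>f' y r\<bar> \<le> w r"
    and w: "integrable M w"
  shows "((\<lambda>y. \<integral>r. f y r \<partial>M) has_real_derivative (\<integral>r. f' x r \<partial>M)) (at x)"
proof -
  define S where "S = {x - e<..<x + e}"
  have S: "x \<in> S" "open S" and inS: "\<And>y. y \<in> S \<longleftrightarrow> \<bar>y - x\<bar> < e"
    using \<open>0 < e\<close> by (auto simp: S_def)
  have "((\<lambda>y. ((\<integral>r. f y r \<partial>M) - (\<integral>r. f x r \<partial>M)) / (y - x)) \<longlongrightarrow> (\<integral>r. f' x r \<partial>M)) (at x within S)"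
    unfolding tendsto_at_iff_sequentially comp_def
  proof (intro allI impI)
    fix X :: "nat \<Rightarrow> real" assume X: "\<forall>i. X i \<in> S - {x}" "X \<longlonglongrightarrow> x"
    have int': "integrable M (f (X i))" "integrable M (f x)" for i
      using X(1) int \<open>0 < e\<close> inS by auto
    have "(\<lambda>i. \<integral>r. (f (X i) r - f x r) / (X i - x) \<partial>M) \<longlonglongrightarrow> (\<integral>r. f' x r \<partial>M)"
    proof (rule integral_dominated_convergence[where w=w, OF meas _ w])
      show "(\<lambda>r. (f (X i) r - f x r) / (X i - x)) \<in> borel_measurable M" for i
        using int' by (intro borel_measurable_divide borel_measurable_diff) auto
      show "AE r in M. (\<lambda>i. (f (X i) r - f x r) / (X i - x)) \<longlonglongrightarrow> f' x r"
      proof (rule AE_I2)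
        fix r
        have "((\<lambda>y. (f y r - f x r) / (y - x)) \<longlongrightarrow> f' x r) (at x within S)"
          using f'[of x r] \<open>0 < e\<close> unfolding has_field_derivative_iff by (auto intro: tendsto_within_subset)
        then show "(\<lambda>i. (f (X i) r - f x r) / (X i - x)) \<longlonglongrightarrow> f' x r"
          using X unfolding tendsto_at_iff_sequentially comp_def by blast
      qed
      show "AE r in M. norm ((f (X i) r - f x r) / (X i - x)) \<le> w r" for i
      proof (rule AE_I2)
        fix r
        have Xi: "X i \<in> S" "X i \<noteq> x" using X(1) by auto
        have "norm (f (X i) r - f x r) \<le> w r * norm (X i - x)"
        proof (rule field_differentiable_bound[where S=S])
          show "convex S" by (simp add: S_def)
          show "((\<lambda>y. f y r) has_field_derivative f' y r) (at y within S)" if "y \<in> S" for y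
            using f' that inS has_field_derivative_at_within by blast
          show "norm (f' y r) \<le> w r" if "y \<in> S" for y
            using bound that inS by simp
        qed (use Xi S in auto)
        then show "norm ((f (X i) r - f x r) / (X i - x)) \<le> w r"
          using Xi by (simp add: field_simps)
      qed
    qed
    moreover have eq: "(\<integral>r. (f (X i) r - f x r) / (X i - x) \<partial>M)
        = ((\<integral>r. f (X i) r \<partial>M) - (\<integral>r. f x r \<partial>M)) / (X i - x)" for i
      using int' by simp
    ultimately show "(\<lambda>i. ((\<integral>r. f (X i) r \<partial>M) - (\<integral>r. f x r \<partial>M)) / (X i - x)) \<longlonglongrightarrow> (\<integral>r. f' x r \<partial>M)"
      unfolding eq by simp
  qed
  then show ?thesis
    unfolding has_field_derivative_iff at_within_open[OF S] .
qed

section \<open>Gamma and inverse Gamma weights: mass, decay and derivatives\<close>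

definition gamma_weight :: "real \<Rightarrow> real \<Rightarrow> real" where
  "gamma_weight p u = (if 0 < u then u powr (p - 1) * exp (- u) else 0)"

text \<open>The unnormalised inverse Gamma density of scale \<open>q\<close> and shape
  \<open>p\<close>. For \<open>q = x\<^sup>2 / 4\<close> and \<open>p = s\<close> it is the
  extension kernel up to the factor \<open>x powr (2 * s) / (4 powr s * Gamma s)\<close>. The value
  0 off the positive axis allows integration over the whole line.\<close>

definition inverse_gamma_weight :: "real \<Rightarrow> real \<Rightarrow> real \<Rightarrow> real" where
  "inverse_gamma_weight q p \<tau> = (if 0 < \<tau> then exp (- q / \<tau>) * \<tau> powr (- p - 1) else 0)"

lemma gamma_weight_measurable [measurable]: "gamma_weight p \<in> borel_measurable borel"
  unfolding gamma_weight_def by measurable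

lemma inverse_gamma_weight_measurable [measurable]: "inverse_gamma_weight q p \<in> borel_measurable borel"
  unfolding inverse_gamma_weight_def by measurable

lemma gamma_weight_nonneg [simp]: "0 \<le> gamma_weight p u"
  by (simp add: gamma_weight_def)

lemma inverse_gamma_weight_nonneg [simp]: "0 \<le> inverse_gamma_weight q p u"
  by (simp add: inverse_gamma_weight_def)

lemma has_bochner_integral_gamma_weight:
  assumes "0 < p"
  shows "has_bochner_integral lborel (gamma_weight p) (Gamma p)"
proof (rule has_bochner_integral_nn_integral)
  have "gamma_weight p = (\<lambda>t. indicator {0..} t * t powr (p - 1) / exp t)"
    by (auto simp: gamma_weight_def indicator_def exp_minus field_simps fun_eq_iff)
  then show "(\<integral>\<^sup>+ x. ennreal (gamma_weight p x) \<partial>lborel) = ennreal (Gamma p)"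
    using Gamma_conv_nn_integral_real[OF assms] by simp
qed (use assms in auto)

lemma integrable_mult_bounded:
  fixes w \<psi> :: "real \<Rightarrow> real"
  assumes "integrable lborel w" "\<psi> \<in> borel_measurable borel" "\<And>r. \<bar>\<psi> r\<bar> \<le> M"
  shows "integrable lborel (\<lambda>r. w r * \<psi> r)"
proof (rule Bochner_Integration.integrable_bound)
  show "integrable lborel (\<lambda>r. M * w r)" using assms(1) by simp
  show "(\<lambda>r. w r * \<psi> r) \<in> borel_measurable lborel" using assms by measurable
  have "\<bar>w r\<bar> * \<bar>\<psi> r\<bar> \<le> M * \<bar>w r\<bar>" for r
    using mult_left_mono[OF assms(3), of "\<bar>w r\<bar>" r] by (simp add: mult.commute)
  moreover have "\<bar>M\<bar> = M" using assms(3)[of 0] by simp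
  ultimately show "AE r in lborel. norm (w r * \<psi> r) \<le> norm (M * w r)"
    by (simp add: abs_mult)
qed

text \<open>The substitution \<open>u = q / \<tau>\<close>. Keeping a general bounded
  \<open>\<psi>\<close> yields both the integrability of the weight, from \<open>\<psi> = 1\<close>,
  and the kernel form of the extension.\<close>

lemma inverse_gamma_weight_substitution:
  assumes "0 < q" "0 < p" and [measurable]: "\<psi> \<in> borel_measurable borel" and \<psi>: "\<And>r. \<bar>\<psi> r\<bar> \<le> M"
  shows "has_bochner_integral lborel (\<lambda>\<tau>. inverse_gamma_weight q p \<tau> * \<psi> \<tau>)
           (q powr (- p) * (\<integral>u. gamma_weight p u * \<psi> (q / u) \<partial>lborel))"
proof -
  define f where "f = (\<lambda>u. gamma_weight p u * \<psi> (q / u))"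
  have f_meas [measurable]: "f \<in> borel_measurable borel" unfolding f_def by measurable
  have "integrable lborel f" unfolding f_def
    using has_bochner_integral_gamma_weight[OF \<open>0 < p\<close>] \<psi>
    by (intro integrable_mult_bounded[where M=M]) (auto simp: has_bochner_integral_iff)
  \<comment> \<open>The change of variables theorem is about Lebesgue measure; since all functions
    involved are Borel, passing to the completion and back preserves integrability and
    integrals.\<close>
  then have f_int: "integrable lebesgue f"
    by (subst integrable_completion) auto
  have f_ind: "(\<lambda>x. indicator {0<..} x *\<^sub>R f x) = f"
    by (auto simp: f_def gamma_weight_def indicator_def)
  have abs_f: "f absolutely_integrable_on {0<..}"
    using f_int unfolding set_integrable_def f_ind .
  have int_f: "integral {0<..} f = (\<integral>u. f u \<partial>lborel)"
    using set_lebesgue_integral_eq_integral(2)[OF abs_f]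
    unfolding set_lebesgue_integral_def f_ind by (simp add: integral_completion)
  have img: "(\<lambda>\<tau>. q / \<tau>) ` {0<..} = {0<..}"
  proof -
    have "u \<in> (\<lambda>\<tau>. q / \<tau>) ` {0<..}" if "0 < u" for u
      using that \<open>0 < q\<close> by (intro image_eqI[of _ _ "q / u"]) auto
    then show ?thesis using \<open>0 < q\<close> by auto
  qed
  define g where "g = (\<lambda>\<tau>. \<bar>- q / \<tau>\<^sup>2\<bar> * f (q / \<tau>))"
  have g: "g absolutely_integrable_on {0<..}" "integral {0<..} g = integral {0<..} f"
  proof -
    have "((\<lambda>\<tau>. q / \<tau>) has_real_derivative - q / \<tau>\<^sup>2) (at \<tau> within {0<..})" if "\<tau> \<in> {0<..}" for \<tau>
      using that by (auto intro!: derivative_eq_intros simp: power2_eq_square)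
    moreover have "inj_on (\<lambda>\<tau>. q / \<tau>) {0<..}"
      using \<open>0 < q\<close> by (auto intro!: inj_onI simp: field_simps)
    ultimately have "g absolutely_integrable_on {0<..} \<and> integral {0<..} g = integral {0<..} f"
      using has_absolute_integral_change_of_variables_1'[of "{0<..}" "\<lambda>\<tau>. q / \<tau>" "\<lambda>\<tau>. - q / \<tau>\<^sup>2" f "integral {0<..} f"]
        abs_f unfolding g_def img by simp
    then show "g absolutely_integrable_on {0<..}" "integral {0<..} g = integral {0<..} f" by auto
  qed
  \<comment> \<open>The Jacobian \<open>q / \<tau>\<^sup>2\<close> combines with the power of
    \<open>q / \<tau>\<close> to the exponent \<open>- p - 1\<close> of the inverse weight.\<close>
  have g_eq: "indicator {0<..} \<tau> *\<^sub>R g \<tau> = q powr p * (inverse_gamma_weight q p \<tau> * \<psi> \<tau>)" for \<tau>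
  proof (cases "0 < \<tau>")
    case True
    have e1: "\<tau> powr (- p - 1) = inverse (\<tau> powr p * \<tau>)"
      using True powr_minus[of \<tau> "p + 1"] by (simp add: powr_add)
    have e2: "(q / \<tau>) powr (p - 1) = q powr p / \<tau> powr p * (\<tau> / q)"
      using True \<open>0 < q\<close> by (simp add: powr_divide powr_diff)
    have "q / \<tau>\<^sup>2 * (q / \<tau>) powr (p - 1) = q powr p * \<tau> powr (- p - 1)"
      unfolding e1 e2 using True \<open>0 < q\<close> by (simp add: field_simps power2_eq_square)
    then have "q / \<tau>\<^sup>2 * ((q / \<tau>) powr (p - 1) * exp (- q / \<tau>) * \<psi> \<tau>)
        = q powr p * (exp (- q / \<tau>) * \<tau> powr (- p - 1) * \<psi> \<tau>)"
      using arg_cong[of _ _ "\<lambda>z. z * (exp (- q / \<tau>) * \<psi> \<tau>)"] by (simp only: mult_ac)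
    then show ?thesis using True \<open>0 < q\<close>
      by (simp add: g_def f_def gamma_weight_def inverse_gamma_weight_def)
  qed (simp add: inverse_gamma_weight_def)
  have "integrable lebesgue (\<lambda>\<tau>. q powr p * (inverse_gamma_weight q p \<tau> * \<psi> \<tau>))"
    using g(1) unfolding set_integrable_def g_eq .
  then have 1: "integrable lborel (\<lambda>\<tau>. inverse_gamma_weight q p \<tau> * \<psi> \<tau>)"
    using \<open>0 < q\<close> by (subst (asm) integrable_completion) auto
  have "(\<integral>\<tau>. q powr p * (inverse_gamma_weight q p \<tau> * \<psi> \<tau>) \<partial>lebesgue) = integral {0<..} g"
    using set_lebesgue_integral_eq_integral(2)[OF g(1)] unfolding set_lebesgue_integral_def g_eq .
  then have "q powr p * (\<integral>\<tau>. inverse_gamma_weight q p \<tau> * \<psi> \<tau> \<partial>lborel) = (\<integral>u. f u \<partial>lborel)"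
    using g(2) int_f by (subst (asm) integral_completion) auto
  then show ?thesis using 1 \<open>0 < q\<close>
    by (simp add: has_bochner_integral_iff f_def powr_minus field_simps)
qed

lemma integrable_inverse_gamma_weight:
  assumes "0 < q" "0 < p"
  shows "integrable lborel (inverse_gamma_weight q p)"
proof -
  have "integrable lborel (\<lambda>\<tau>. inverse_gamma_weight q p \<tau> * 1)"
    by (rule integrable.intros, rule inverse_gamma_weight_substitution[OF assms, where M=1]) auto
  then show ?thesis by simp
qed

text \<open>The bound is \<open>ln z \<le> z - 1\<close> at \<open>z = q / (m * \<tau>)\<close>. It
  is sharp at \<open>\<tau> = q / m\<close>, so \<open>C\<close> is the maximum of the weight. The
  range \<open>-1 < p\<close> includes the shape \<open>p - 2\<close> that occurs in the decay
  estimate.\<close>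

lemma inverse_gamma_weight_bounded:
  assumes "0 < q" "-1 < p"
  obtains C where "0 \<le> C" "\<And>\<tau>. inverse_gamma_weight q p \<tau> \<le> C"
proof
  define m where "m = p + 1"
  have m: "0 < m" using assms by (simp add: m_def)
  define C where "C = exp (- m - m * ln (q / m))"
  show "0 \<le> C" by (simp add: C_def)
  fix \<tau>
  show "inverse_gamma_weight q p \<tau> \<le> C"
  proof (cases "0 < \<tau>")
    case True
    have "ln (q / (m * \<tau>)) \<le> q / (m * \<tau>) - 1"
      using True assms m by (intro ln_le_minus_one) auto
    then have "m * ln (q / (m * \<tau>)) \<le> m * (q / (m * \<tau>) - 1)" using m by (intro mult_left_mono) auto
    moreover have "ln (q / (m * \<tau>)) = ln (q / m) - ln \<tau>"
      using True assms m by (simp add: ln_div ln_mult)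
    moreover have "m * (q / (m * \<tau>) - 1) = q / \<tau> - m" using m True by (simp add: field_simps)
    ultimately have "- q / \<tau> - m * ln \<tau> \<le> - m - m * ln (q / m)"
      by (simp add: right_diff_distrib)
    moreover have "inverse_gamma_weight q p \<tau> = exp (- q / \<tau> - m * ln \<tau>)"
      using True by (simp add: inverse_gamma_weight_def powr_def m_def algebra_simps flip: exp_add)
    ultimately show ?thesis by (simp add: C_def)
  qed (auto simp: C_def inverse_gamma_weight_def)
qed

text \<open>Powers of \<open>\<tau>\<close> can be traded for shifts of the shape, which turns
  uniform bounds into decay and keeps derivatives within the same family.\<close>

lemma inverse_gamma_weight_shift2: "inverse_gamma_weight q p \<tau> = \<tau>\<^sup>2 * inverse_gamma_weight q (p + 2) \<tau>"
proof (cases "0 < \<tau>")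
  case True
  have "\<tau> powr (- p - 1) = \<tau> powr (2 + (- (p + 2) - 1))"
    by (rule arg_cong[where f="\<lambda>a. \<tau> powr a"]) simp
  also have "\<dots> = \<tau>\<^sup>2 * \<tau> powr (- (p + 2) - 1)"
    using True by (subst powr_add) (simp add: powr_numeral)
  finally show ?thesis using True by (simp add: inverse_gamma_weight_def)
qed (simp add: inverse_gamma_weight_def)

lemma inverse_gamma_weight_shift1: "inverse_gamma_weight q p \<tau> = \<tau> * inverse_gamma_weight q (p + 1) \<tau>"
proof (cases "0 < \<tau>")
  case True
  have "\<tau> powr (- p - 1) = \<tau> powr (1 + (- (p + 1) - 1))"
    by (rule arg_cong[where f="\<lambda>a. \<tau> powr a"]) simp
  also have "\<dots> = \<tau> * \<tau> powr (- (p + 1) - 1)"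
    using True by (subst powr_add) simp
  finally show ?thesis using True by (simp add: inverse_gamma_weight_def)
qed (simp add: inverse_gamma_weight_def)

text \<open>Multiplying by \<open>1 + \<tau>\<^sup>2\<close> gives the sum of the weights of shapes
  \<open>p\<close> and \<open>p - 2\<close>, both bounded. The result supplies an integrable
  majorant that is stable under small translations.\<close>

lemma inverse_gamma_weight_decay:
  assumes "0 < q" "1 < p"
  obtains C where "0 \<le> C" "\<And>\<tau>. inverse_gamma_weight q p \<tau> \<le> C / (1 + \<tau>\<^sup>2)"
proof -
  obtain C1 where C1: "0 \<le> C1" "\<And>\<tau>. inverse_gamma_weight q p \<tau> \<le> C1"
    using inverse_gamma_weight_bounded[of q p] assms by auto
  obtain C2 where C2: "0 \<le> C2" "\<And>\<tau>. inverse_gamma_weight q (p - 2) \<tau> \<le> C2"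
    using inverse_gamma_weight_bounded[of q "p - 2"] assms by auto
  show thesis
  proof
    show "0 \<le> C1 + C2" using C1 C2 by simp
    fix \<tau>
    have "(1 + \<tau>\<^sup>2) * inverse_gamma_weight q p \<tau> = inverse_gamma_weight q p \<tau> + inverse_gamma_weight q (p - 2) \<tau>"
      using inverse_gamma_weight_shift2[of q "p - 2" \<tau>] by (simp add: algebra_simps)
    also have "\<dots> \<le> C1 + C2" using C1 C2 by (intro add_mono)
    finally show "inverse_gamma_weight q p \<tau> \<le> (C1 + C2) / (1 + \<tau>\<^sup>2)"
      by (simp add: field_simps add_pos_nonneg)
  qed
qed

lemma inverse_gamma_weight_deriv_scale:
  "((\<lambda>q. inverse_gamma_weight q p \<tau>) has_real_derivative - inverse_gamma_weight q (p + 1) \<tau>) (at q)"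
proof (cases "0 < \<tau>")
  case True
  have "((\<lambda>q. exp (- q / \<tau>) * \<tau> powr (- p - 1)) has_real_derivative
      - (exp (- q / \<tau>) * \<tau> powr (- p - 1)) / \<tau>) (at q)"
    using True by (auto intro!: derivative_eq_intros)
  moreover have "inverse_gamma_weight q (p + 1) \<tau> = exp (- q / \<tau>) * \<tau> powr (- p - 1) / \<tau>"
    using True inverse_gamma_weight_shift1[of q p \<tau>] by (simp add: inverse_gamma_weight_def)
  ultimately show ?thesis using True by (simp add: inverse_gamma_weight_def)
qed (simp add: inverse_gamma_weight_def)

text \<open>The factor \<open>exp (- q / \<tau>)\<close> makes the weight vanish fast enough at 0
  for the formula to hold across the origin. This matters because the time derivative of the
  convolution will fall on the weight.\<close>

lemma inverse_gamma_weight_deriv: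
  assumes "0 < q" "0 < p"
  shows "(inverse_gamma_weight q p has_real_derivative
           q * inverse_gamma_weight q (p + 2) \<tau> - (p + 1) * inverse_gamma_weight q (p + 1) \<tau>) (at \<tau>)"
proof -
  consider "0 < \<tau>" | "\<tau> < 0" | "\<tau> = 0" by linarith
  then show ?thesis
  proof cases
    case 1
    define g where "g = (\<lambda>\<tau>. exp (- q / \<tau>) * \<tau> powr (- p - 1))"
    have "(g has_real_derivative q * (g \<tau> / \<tau>\<^sup>2) - (p + 1) * (g \<tau> / \<tau>)) (at \<tau>)"
    proof -
      have "\<tau> powr (- p - 1) = \<tau> * \<tau> powr (- p - 2)"
        using 1 powr_diff[of \<tau> "- p - 1" 1] by (simp add: algebra_simps)
      then show ?thesis using 1 unfolding g_def
        by (auto intro!: derivative_eq_intros simp: field_simps power2_eq_square)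
    qed
    moreover have w: "inverse_gamma_weight q p \<tau> = g \<tau>"
      using 1 by (simp add: g_def inverse_gamma_weight_def)
    moreover have "inverse_gamma_weight q (p + 2) \<tau> = g \<tau> / \<tau>\<^sup>2"
      using 1 inverse_gamma_weight_shift2[of q p \<tau>] unfolding w by (simp add: field_simps)
    moreover have "inverse_gamma_weight q (p + 1) \<tau> = g \<tau> / \<tau>"
      using 1 inverse_gamma_weight_shift1[of q p \<tau>] unfolding w by (simp add: field_simps)
    ultimately have "(g has_real_derivative
        q * inverse_gamma_weight q (p + 2) \<tau> - (p + 1) * inverse_gamma_weight q (p + 1) \<tau>) (at \<tau>)" by simp
    then show ?thesis
      by (rule has_field_derivative_transform_within_open[where S="{0<..}"])
        (use 1 in \<open>auto simp: g_def inverse_gamma_weight_def\<close>)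
  next
    case 2
    have "((\<lambda>_. 0) has_real_derivative 0) (at \<tau>)" by simp
    then have "(inverse_gamma_weight q p has_real_derivative 0) (at \<tau>)"
      by (rule has_field_derivative_transform_within_open[where S="{..<0}"])
        (use 2 in \<open>auto simp: inverse_gamma_weight_def\<close>)
    then show ?thesis using 2 by (simp add: inverse_gamma_weight_def)
  next
    \<comment> \<open>All weights vanish at 0, so the claimed derivative is 0. The difference
      quotient is \<open>h\<close> times the bounded weight of shape \<open>p + 2\<close>.\<close>
    case 3
    obtain C where C: "0 \<le> C" "\<And>\<tau>. inverse_gamma_weight q (p + 2) \<tau> \<le> C"
      using inverse_gamma_weight_bounded[of q "p + 2"] assms by auto
    have "((\<lambda>h. (inverse_gamma_weight q p h - inverse_gamma_weight q p 0) / (h - 0)) \<longlongrightarrow> 0) (at 0)"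
    proof (rule Lim_null_comparison)
      have "norm (inverse_gamma_weight q p h / h) \<le> C * \<bar>h\<bar>" for h
      proof -
        have "inverse_gamma_weight q p h / h = h * inverse_gamma_weight q (p + 2) h"
          unfolding inverse_gamma_weight_shift2[of q p h] by (simp add: power2_eq_square)
        then show ?thesis using mult_left_mono[OF C(2)[of h], of "\<bar>h\<bar>"]
          by (simp add: abs_mult mult.commute[of C])
      qed
      then show "\<forall>\<^sub>F h in at 0. norm ((inverse_gamma_weight q p h - inverse_gamma_weight q p 0) / (h - 0)) \<le> C * \<bar>h\<bar>"
        by (simp add: inverse_gamma_weight_def)
      show "((\<lambda>h. C * \<bar>h\<bar>) \<longlongrightarrow> 0) (at 0)" by (auto intro!: tendsto_eq_intros)
    qed
    then show ?thesis using 3 by (simp add: has_field_derivative_iff inverse_gamma_weight_def)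
  qed
qed

lemma integrable_inverse_1_plus_square_lborel: "integrable lborel (\<lambda>x::real. inverse (1 + x\<^sup>2))"
  using integrable_inverse_1_plus_square by (simp add: set_integrable_def)

section \<open>Potentials with inverse Gamma kernel and their derivatives in scale and time\<close>

definition potential :: "real \<Rightarrow> real \<Rightarrow> (real \<Rightarrow> real) \<Rightarrow> real \<Rightarrow> real" where
  "potential q p \<phi> t = (\<integral>\<tau>. inverse_gamma_weight q p \<tau> * \<phi> (t - \<tau>) \<partial>lborel)"

text \<open>The weight decreases in its scale, so for scales within \<open>q / 2\<close> of
  \<open>q\<close> the weight of scale \<open>q / 2\<close> gives a common majorant.\<close>

lemma potential_deriv_scale:
  assumes "0 < q" "0 < p" and [measurable]: "\<phi> \<in> borel_measurable borel" and \<phi>: "\<And>r. \<bar>\<phi> r\<bar> \<le> M"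
  shows "((\<lambda>q. potential q p \<phi> t) has_real_derivative - potential q (p + 1) \<phi> t) (at q)"
proof -
  have "((\<lambda>y. \<integral>\<tau>. inverse_gamma_weight y p \<tau> * \<phi> (t - \<tau>) \<partial>lborel) has_real_derivative
      (\<integral>\<tau>. - inverse_gamma_weight q (p + 1) \<tau> * \<phi> (t - \<tau>) \<partial>lborel)) (at q)"
  proof (rule has_real_derivative_integral[where e="q / 2" and w="\<lambda>\<tau>. inverse_gamma_weight (q / 2) (p + 1) \<tau> * M"])
    show "0 < q / 2" using assms by simp
    show "integrable lborel (\<lambda>\<tau>. inverse_gamma_weight (q / 2) (p + 1) \<tau> * M)"
      using integrable_inverse_gamma_weight[of "q / 2" "p + 1"] assms by simp
    fix y assume "\<bar>y - q\<bar> < q / 2"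
    then have y: "q / 2 \<le> y" "0 < y" using \<open>0 < q\<close> by (auto simp: abs_if split: if_splits)
    show "integrable lborel (\<lambda>\<tau>. inverse_gamma_weight y p \<tau> * \<phi> (t - \<tau>))"
      using integrable_inverse_gamma_weight[OF y(2) \<open>0 < p\<close>] by (rule integrable_mult_bounded) (use \<phi> in auto)
    fix \<tau>
    show "((\<lambda>y. inverse_gamma_weight y p \<tau> * \<phi> (t - \<tau>)) has_real_derivative
        - inverse_gamma_weight y (p + 1) \<tau> * \<phi> (t - \<tau>)) (at y)"
      by (rule DERIV_cmult_right[OF inverse_gamma_weight_deriv_scale])
    have "inverse_gamma_weight y (p + 1) \<tau> \<le> inverse_gamma_weight (q / 2) (p + 1) \<tau>"
    proof (cases "0 < \<tau>")
      case True
      then have "q / 2 / \<tau> \<le> y / \<tau>" using y by (intro divide_right_mono) auto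
      then show ?thesis using True by (auto simp: inverse_gamma_weight_def intro!: mult_right_mono)
    qed (simp add: inverse_gamma_weight_def)
    then have "inverse_gamma_weight y (p + 1) \<tau> * \<bar>\<phi> (t - \<tau>)\<bar> \<le> inverse_gamma_weight (q / 2) (p + 1) \<tau> * M"
      using \<phi>[of "t - \<tau>"] by (intro mult_mono) auto
    then show "\<bar>- inverse_gamma_weight y (p + 1) \<tau> * \<phi> (t - \<tau>)\<bar> \<le> inverse_gamma_weight (q / 2) (p + 1) \<tau> * M"
      by (simp add: abs_mult)
  qed measurable
  then show ?thesis by (simp add: potential_def)
qed

text \<open>Reflecting the variable moves \<open>t\<close> from \<open>\<phi>\<close>, which may
  fail to be differentiable, into the kernel.\<close>

lemma potential_conv_convolution:
  "potential q p \<phi> t = (\<integral>r. inverse_gamma_weight q p (t - r) * \<phi> r \<partial>lborel)"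
  unfolding potential_def by (subst lborel_integral_real_affine[where c="-1" and t=t]) auto

lemma potential_deriv_time:
  assumes "0 < q" "0 < p" and [measurable]: "\<phi> \<in> borel_measurable borel" and \<phi>: "\<And>r. \<bar>\<phi> r\<bar> \<le> M"
  shows "(potential q p \<phi> has_real_derivative q * potential q (p + 2) \<phi> t - (p + 1) * potential q (p + 1) \<phi> t) (at t)"
proof -
  let ?w' = "\<lambda>\<tau>. q * inverse_gamma_weight q (p + 2) \<tau> - (p + 1) * inverse_gamma_weight q (p + 1) \<tau>"
  have M: "0 \<le> M" using \<phi>[of 0] by simp
  obtain C1 where C1: "0 \<le> C1" "\<And>\<tau>. inverse_gamma_weight q (p + 1) \<tau> \<le> C1 / (1 + \<tau>\<^sup>2)"
    using inverse_gamma_weight_decay[of q "p + 1"] assms by auto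
  obtain C2 where C2: "0 \<le> C2" "\<And>\<tau>. inverse_gamma_weight q (p + 2) \<tau> \<le> C2 / (1 + \<tau>\<^sup>2)"
    using inverse_gamma_weight_decay[of q "p + 2"] assms by auto
  define D where "D = q * C2 + (p + 1) * C1"
  have D: "0 \<le> D" using C1 C2 assms by (simp add: D_def)
  have w': "\<bar>?w' \<tau>\<bar> \<le> D / (1 + \<tau>\<^sup>2)" for \<tau>
  proof -
    have "\<bar>?w' \<tau>\<bar> \<le> q * inverse_gamma_weight q (p + 2) \<tau> + (p + 1) * inverse_gamma_weight q (p + 1) \<tau>"
      using assms by (intro abs_triangle_ineq4[THEN order_trans]) (simp add: abs_mult)
    also have "\<dots> \<le> q * (C2 / (1 + \<tau>\<^sup>2)) + (p + 1) * (C1 / (1 + \<tau>\<^sup>2))"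
      using C1 C2 assms by (intro add_mono mult_left_mono) auto
    finally show ?thesis by (simp add: D_def add_divide_distrib)
  qed
  have int: "integrable lborel (\<lambda>r. inverse_gamma_weight q p (y - r) * \<phi> r)" if "0 < p" for y p
    using lborel_integrable_real_affine[OF integrable_inverse_gamma_weight[OF \<open>0 < q\<close> that], of "-1" y] \<phi>
    by (intro integrable_mult_bounded) auto
  have "((\<lambda>t. \<integral>r. inverse_gamma_weight q p (t - r) * \<phi> r \<partial>lborel) has_real_derivative
      (\<integral>r. ?w' (t - r) * \<phi> r \<partial>lborel)) (at t)"
  proof (rule has_real_derivative_integral[where e=1 and w="\<lambda>r. 3 * D * M * inverse (1 + (t - r)\<^sup>2)"])
    show "integrable lborel (\<lambda>r. 3 * D * M * inverse (1 + (t - r)\<^sup>2))"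
      using lborel_integrable_real_affine[OF integrable_inverse_1_plus_square_lborel, of "-1" t] by simp
    fix y assume y: "\<bar>y - t\<bar> < 1"
    show "integrable lborel (\<lambda>r. inverse_gamma_weight q p (y - r) * \<phi> r)" using int \<open>0 < p\<close> by blast
    fix r
    have "((\<lambda>y. inverse_gamma_weight q p (y - r)) has_real_derivative ?w' (y - r) * 1) (at y)"
      by (rule DERIV_chain2[where g="\<lambda>y. y - r"])
        (auto intro!: inverse_gamma_weight_deriv derivative_eq_intros assms)
    then show "((\<lambda>y. inverse_gamma_weight q p (y - r) * \<phi> r) has_real_derivative ?w' (y - r) * \<phi> r) (at y)"
      using DERIV_cmult_right by fastforce
    \<comment> \<open>This inequality yields the factor 3 of the majorant: for \<open>y\<close>
      within distance 1 of \<open>t\<close>, the value \<open>1 + (t - r)\<^sup>2\<close> is at most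
      \<open>3 + 2 * (y - r)\<^sup>2\<close>.\<close>
    have sq: "(a + b)\<^sup>2 \<le> 2 * a\<^sup>2 + 2 * b\<^sup>2" for a b :: real
      using zero_le_power2[of "a - b"] unfolding power2_sum power2_diff by simp
    have "(t - r)\<^sup>2 \<le> 2 * (t - y)\<^sup>2 + 2 * (y - r)\<^sup>2"
      using sq[of "t - y" "y - r"] by simp
    moreover have "(t - y)\<^sup>2 \<le> 1" using y by (simp add: abs_square_le_1 abs_minus_commute)
    moreover have "1 + A \<le> 3 * (1 + B)" if "A \<le> 2 * E + 2 * B" "E \<le> 1" "0 \<le> B" for A B E :: real
      using that by simp
    ultimately have "1 + (t - r)\<^sup>2 \<le> 3 * (1 + (y - r)\<^sup>2)"
      using zero_le_power2[of "y - r"] by blast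
    then have "1 / (1 + (y - r)\<^sup>2) \<le> 3 / (1 + (t - r)\<^sup>2)"
      by (simp add: field_simps add_pos_nonneg)
    then have "D * (1 / (1 + (y - r)\<^sup>2)) \<le> D * (3 / (1 + (t - r)\<^sup>2))"
      using D by (rule mult_left_mono)
    then have "\<bar>?w' (y - r)\<bar> \<le> 3 * D / (1 + (t - r)\<^sup>2)" using w'[of "y - r"] by (simp add: mult.commute)
    then have "\<bar>?w' (y - r)\<bar> * \<bar>\<phi> r\<bar> \<le> 3 * D / (1 + (t - r)\<^sup>2) * M"
      using \<phi> by (intro mult_mono) (auto intro: order_trans[OF abs_ge_zero])
    then show "\<bar>?w' (y - r) * \<phi> r\<bar> \<le> 3 * D * M * inverse (1 + (t - r)\<^sup>2)"
      by (simp add: abs_mult divide_inverse mult_ac)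
  qed auto
  also have "(\<integral>r. ?w' (t - r) * \<phi> r \<partial>lborel)
      = (\<integral>r. q * (inverse_gamma_weight q (p + 2) (t - r) * \<phi> r) - (p + 1) * (inverse_gamma_weight q (p + 1) (t - r) * \<phi> r) \<partial>lborel)"
    by (simp add: algebra_simps)
  also have "\<dots> = q * potential q (p + 2) \<phi> t - (p + 1) * potential q (p + 1) \<phi> t"
    using int[of "p + 2" t] int[of "p + 1" t] \<open>0 < p\<close>
    by (subst Bochner_Integration.integral_diff) (auto simp: potential_conv_convolution)
  finally show ?thesis unfolding potential_conv_convolution .
qed

section \<open>The Poisson-type integral\<close>

text \<open>The integral uses the Gamma variable \<open>u = x\<^sup>2 / (4 * \<tau>)\<close> instead
  of \<open>\<tau>\<close>: the weight is then independent of \<open>x\<close> and \<open>t\<close>,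
  and the formula remains meaningful at \<open>x = 0\<close>. At \<open>u = 0\<close> the weight is
  0, so the division there is harmless.\<close>

definition poisson_extension :: "real \<Rightarrow> (real \<Rightarrow> real) \<Rightarrow> real \<Rightarrow> real \<Rightarrow> real" where
  "poisson_extension s \<phi> x t = (\<integral>u. gamma_weight s u * \<phi> (t - x\<^sup>2 / (4 * u)) \<partial>lborel) / Gamma s"

text \<open>Returning to the variable \<open>\<tau>\<close> puts the dependence on \<open>x\<close>
  into the scale of the kernel, the form that can be differentiated without differentiating
  \<open>\<phi>\<close>.\<close>

lemma poisson_extension_conv_potential:
  assumes "0 < s" "0 < x" and [measurable]: "\<phi> \<in> borel_measurable borel" and \<phi>: "\<And>r. \<bar>\<phi> r\<bar> \<le> M"
  shows "poisson_extension s \<phi> x t = 1 / (4 powr s * Gamma s) * x powr (2 * s) * potential (x\<^sup>2 / 4) s \<phi> t"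
proof -
  have "potential (x\<^sup>2 / 4) s \<phi> t
      = (x\<^sup>2 / 4) powr (- s) * (\<integral>u. gamma_weight s u * \<phi> (t - (x\<^sup>2 / 4) / u) \<partial>lborel)"
    unfolding potential_def using assms
    by (intro has_bochner_integral_integral_eq inverse_gamma_weight_substitution[where M=M]) auto
  moreover have "(x\<^sup>2 / 4) powr (- s) = 4 powr s / x powr (2 * s)"
  proof -
    have "x\<^sup>2 powr s = x powr (2 * s)" using \<open>0 < x\<close> by (simp add: powr_powr flip: powr_numeral)
    then show ?thesis using \<open>0 < x\<close> by (simp add: powr_minus powr_divide)
  qed
  ultimately show ?thesis using \<open>0 < x\<close> by (simp add: poisson_extension_def)
qed

text \<open>Derivatives in \<open>x\<close> pass through the scale \<open>x\<^sup>2 / 4\<close> by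
  the chain rule, each raising the shape by one. All three derivatives are expressed through the
  shapes \<open>s\<close>, \<open>s + 1\<close> and \<open>s + 2\<close>, so the equation reduces to
  an identity between coefficients.\<close>

lemma poisson_extension_derivs:
  assumes s: "0 < s" and x: "0 < x" and \<phi>: "\<phi> \<in> borel_measurable borel" "\<And>r. \<bar>\<phi> r\<bar> \<le> M"
  defines "c \<equiv> 1 / (4 powr s * Gamma s)" and "L \<equiv> \<lambda>p x. potential (x\<^sup>2 / 4) p \<phi>"
  shows "((\<lambda>x. poisson_extension s \<phi> x t) has_real_derivative
           c * x powr (2 * s) * (2 * s / x * L s x t - x / 2 * L (s + 1) x t)) (at x)" (is ?thesis1)
    and "((\<lambda>x. c * x powr (2 * s) * (2 * s / x * L s x t - x / 2 * L (s + 1) x t)) has_real_derivative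
           c * x powr (2 * s) * (2 * s * (2 * s - 1) / x\<^sup>2 * L s x t - (2 * s + 1 / 2) * L (s + 1) x t
             + x\<^sup>2 / 4 * L (s + 2) x t)) (at x)" (is ?thesis2)
    and "(poisson_extension s \<phi> x has_real_derivative
           c * x powr (2 * s) * (x\<^sup>2 / 4 * L (s + 2) x t - (s + 1) * L (s + 1) x t)) (at t)" (is ?thesis3)
proof -
  have L: "((\<lambda>x. L p x t) has_real_derivative - (x / 2) * L (p + 1) x t) (at x)" if "0 < p" for p
  proof -
    have "((\<lambda>x. L p x t) has_real_derivative - L (p + 1) x t * (x / 2)) (at x)"
      unfolding L_def
      by (rule DERIV_chain2[where g="\<lambda>x. x\<^sup>2 / 4", OF potential_deriv_scale])
        (use x that \<phi> in \<open>auto intro!: derivative_eq_intros\<close>)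
    then show ?thesis by (simp add: mult.commute)
  qed
  have eq: "poisson_extension s \<phi> x t = c * x powr (2 * s) * L s x t" if "0 < x" for x t
    unfolding c_def L_def using s that \<phi> by (rule poisson_extension_conv_potential)
  have pw: "((\<lambda>x. x powr (2 * s)) has_real_derivative 2 * s / x * x powr (2 * s)) (at x)"
    using x by (auto intro!: derivative_eq_intros simp: powr_diff)
  have "((\<lambda>x. c * x powr (2 * s) * L s x t) has_real_derivative
      c * x powr (2 * s) * (2 * s / x * L s x t - x / 2 * L (s + 1) x t)) (at x)"
    by (rule DERIV_cong, (rule DERIV_mult DERIV_cmult pw L s)+) (use x in \<open>simp add: field_simps\<close>)
  then show ?thesis1
    by (rule has_field_derivative_transform_within_open[where S="{0<..}"]) (use x eq in auto)
  have 1: "((\<lambda>x. 2 * s / x) has_real_derivative - (2 * s) / x\<^sup>2) (at x)"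
    using x by (auto intro!: derivative_eq_intros simp: power2_eq_square)
  have 2: "((\<lambda>x. x / 2) has_real_derivative 1 / 2) (at x)"
    by (auto intro!: derivative_eq_intros)
  have L2: "L (s + 1 + 1) = L (s + 2)" by (simp add: add.assoc)
  have s1: "0 < s + 1" using s by simp
  show ?thesis2
    by (rule DERIV_cong, (rule DERIV_mult DERIV_diff DERIV_cmult pw L s s1 1 2)+)
      (use x in \<open>simp add: L2 field_simps power2_eq_square\<close>)
  have "(L s x has_real_derivative x\<^sup>2 / 4 * L (s + 2) x t - (s + 1) * L (s + 1) x t) (at t)"
    unfolding L_def using x s \<phi> by (intro potential_deriv_time) auto
  then show ?thesis3
    unfolding eq[OF x, abs_def] by (rule DERIV_cmult)
qed

lemma poisson_extension_0:
  assumes "0 < s"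
  shows "poisson_extension s \<phi> 0 t = \<phi> t"
  using has_bochner_integral_integral_eq[OF has_bochner_integral_gamma_weight[OF assms]] Gamma_real_pos[OF assms]
  by (simp add: poisson_extension_def)

lemma poisson_extension_bound:
  assumes s: "0 < s" and [measurable]: "\<phi> \<in> borel_measurable borel" and \<phi>: "\<And>r. \<bar>\<phi> r\<bar> \<le> M"
  shows "\<bar>poisson_extension s \<phi> x t\<bar> \<le> M"
proof -
  have w: "integrable lborel (gamma_weight s)" "integral\<^sup>L lborel (gamma_weight s) = Gamma s"
    using has_bochner_integral_gamma_weight[OF s] by (auto simp: has_bochner_integral_iff)
  have "\<bar>\<integral>u. gamma_weight s u * \<phi> (t - x\<^sup>2 / (4 * u)) \<partial>lborel\<bar> \<le> (\<integral>u. gamma_weight s u * M \<partial>lborel)"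
  proof (rule integral_abs_bound[THEN order_trans], rule integral_mono)
    show "integrable lborel (\<lambda>u. \<bar>gamma_weight s u * \<phi> (t - x\<^sup>2 / (4 * u))\<bar>)"
      using w \<phi> by (intro integrable_abs integrable_mult_bounded) auto
    show "\<bar>gamma_weight s u * \<phi> (t - x\<^sup>2 / (4 * u))\<bar> \<le> gamma_weight s u * M" for u
      using \<phi> by (auto simp: abs_mult intro: mult_left_mono)
  qed (use w in auto)
  then show ?thesis using w Gamma_real_pos[OF s]
    by (simp add: poisson_extension_def field_simps)
qed

text \<open>Dominated convergence in the Gamma variable, with majorant
  \<open>gamma_weight s u * M\<close>; points with \<open>x = 0\<close> need no separate
  treatment.\<close>

lemma poisson_extension_continuous:
  assumes s: "0 < s" and cont: "continuous_on UNIV \<phi>" and \<phi>: "\<And>r. \<bar>\<phi> r\<bar> \<le> M"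
  shows "continuous_on S (\<lambda>(x, t). poisson_extension s \<phi> x t)"
  unfolding continuous_on_sequentially comp_def
proof (intro allI ballI impI, elim conjE)
  fix X :: "nat \<Rightarrow> real \<times> real" and a assume X: "X \<longlonglongrightarrow> a"
  have [measurable]: "\<phi> \<in> borel_measurable borel" using cont by (rule borel_measurable_continuous_onI)
  have w: "integrable lborel (gamma_weight s)"
    using has_bochner_integral_gamma_weight[OF s] by (auto simp: has_bochner_integral_iff)
  have "(\<lambda>n. \<integral>u. gamma_weight s u * \<phi> (snd (X n) - (fst (X n))\<^sup>2 / (4 * u)) \<partial>lborel)
      \<longlonglongrightarrow> (\<integral>u. gamma_weight s u * \<phi> (snd a - (fst a)\<^sup>2 / (4 * u)) \<partial>lborel)"
  proof (rule integral_dominated_convergence[where w="\<lambda>u. gamma_weight s u * M"])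
    show "AE u in lborel. (\<lambda>n. gamma_weight s u * \<phi> (snd (X n) - (fst (X n))\<^sup>2 / (4 * u)))
        \<longlonglongrightarrow> gamma_weight s u * \<phi> (snd a - (fst a)\<^sup>2 / (4 * u))"
    proof (rule AE_I2)
      fix u
      show "(\<lambda>n. gamma_weight s u * \<phi> (snd (X n) - (fst (X n))\<^sup>2 / (4 * u)))
          \<longlonglongrightarrow> gamma_weight s u * \<phi> (snd a - (fst a)\<^sup>2 / (4 * u))"
      proof (cases "u = 0")
        case False
        then have "(\<lambda>n. snd (X n) - (fst (X n))\<^sup>2 / (4 * u)) \<longlonglongrightarrow> snd a - (fst a)\<^sup>2 / (4 * u)"
          by (intro tendsto_intros X) auto
        moreover have "isCont \<phi> z" for z using cont by (simp add: continuous_on_eq_continuous_at)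
        ultimately show ?thesis by (intro tendsto_mult tendsto_const isCont_tendsto_compose[of _ \<phi>])
      qed (simp add: gamma_weight_def)
    qed
    show "AE u in lborel. norm (gamma_weight s u * \<phi> (snd (X n) - (fst (X n))\<^sup>2 / (4 * u))) \<le> gamma_weight s u * M" for n
      using \<phi> by (auto simp: abs_mult intro!: mult_left_mono)
  qed (use w in auto)
  then show "(\<lambda>n. case X n of (x, t) \<Rightarrow> poisson_extension s \<phi> x t) \<longlonglongrightarrow> (case a of (x, t) \<Rightarrow> poisson_extension s \<phi> x t)"
    using Gamma_real_pos[OF s] unfolding case_prod_unfold poisson_extension_def
    by (intro tendsto_divide tendsto_const) auto
qed

text \<open>The one-sided comparison is applied to \<open>U - V\<close> and to \<open>V - U\<close>,
  which vanish at \<open>x = 0\<close> and are bounded by \<open>N + M\<close>.\<close>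

lemma bounded_extension_solution_unique:
  assumes s: "0 < s" "s < 1" and cont: "continuous_on UNIV \<phi>" and \<phi>: "\<And>r. \<bar>\<phi> r\<bar> \<le> M"
    and U: "extension_solution s \<phi> U" and bdd: "\<And>x t. 0 \<le> x \<Longrightarrow> \<bar>U x t\<bar> \<le> N"
    and x: "0 < x"
  shows "U x t = poisson_extension s \<phi> x t"
proof -
  have meas: "\<phi> \<in> borel_measurable borel" using cont by (rule borel_measurable_continuous_onI)
  define V where "V = poisson_extension s \<phi>"
  define Ux where "Ux = (\<lambda>x t. deriv (\<lambda>\<xi>. U \<xi> t) x)"
  define Uxx where "Uxx = (\<lambda>x t. deriv (deriv (\<lambda>\<xi>. U \<xi> t)) x)"
  define Ut where "Ut = (\<lambda>x t. deriv (\<lambda>\<tau>. U x \<tau>) t)"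
  have U_derivs: "((\<lambda>\<xi>. U \<xi> t) has_real_derivative Ux x t) (at x)"
      "((\<lambda>\<xi>. Ux \<xi> t) has_real_derivative Uxx x t) (at x)"
      "((\<lambda>\<tau>. U x \<tau>) has_real_derivative Ut x t) (at t)"
      "Ut x t = (1 - 2 * s) / x * Ux x t + Uxx x t"
    if "0 < x" for x t
    using U that unfolding extension_solution_def Ux_def Uxx_def Ut_def
      DERIV_deriv_iff_real_differentiable by blast+
  have U_cont: "continuous_on ({0..} \<times> UNIV) (\<lambda>(x, t). U x t)" and U0: "U 0 t = \<phi> t" for t
    using U by (auto simp: extension_solution_def)
  define c where "c = 1 / (4 powr s * Gamma s)"
  define L where "L = (\<lambda>p x. potential (x\<^sup>2 / 4) p \<phi>)"
  define Vx where "Vx = (\<lambda>x t. c * x powr (2 * s) * (2 * s / x * L s x t - x / 2 * L (s + 1) x t))"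
  define Vxx where "Vxx = (\<lambda>x t. c * x powr (2 * s) * (2 * s * (2 * s - 1) / x\<^sup>2 * L s x t
      - (2 * s + 1 / 2) * L (s + 1) x t + x\<^sup>2 / 4 * L (s + 2) x t))"
  define Vt where "Vt = (\<lambda>x t. c * x powr (2 * s) * (x\<^sup>2 / 4 * L (s + 2) x t - (s + 1) * L (s + 1) x t))"
  have V_derivs: "((\<lambda>\<xi>. V \<xi> t) has_real_derivative Vx x t) (at x)"
      "((\<lambda>\<xi>. Vx \<xi> t) has_real_derivative Vxx x t) (at x)"
      "(V x has_real_derivative Vt x t) (at t)"
    if "0 < x" for x t
    unfolding V_def Vx_def Vxx_def Vt_def c_def L_def
    using poisson_extension_derivs[OF s(1) that meas \<phi>] by blast+
  have V_pde: "Vt x t = (1 - 2 * s) / x * Vx x t + Vxx x t" if "0 < x" for x t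
  proof -
    \<comment> \<open>The terms in \<open>L s\<close> cancel, those in \<open>L (s + 1)\<close> add
      up to \<open>- (s + 1)\<close>, and those in \<open>L (s + 2)\<close> agree.\<close>
    have "x\<^sup>2 / 4 * L (s + 2) x t - (s + 1) * L (s + 1) x t
      = (1 - 2 * s) / x * (2 * s / x * L s x t - x / 2 * L (s + 1) x t)
        + (2 * s * (2 * s - 1) / x\<^sup>2 * L s x t - (2 * s + 1 / 2) * L (s + 1) x t + x\<^sup>2 / 4 * L (s + 2) x t)"
      using that by (simp add: field_simps power2_eq_square)
    from arg_cong[OF this, of "\<lambda>z. c * x powr (2 * s) * z"] show ?thesis
      unfolding Vt_def Vx_def Vxx_def distrib_left[of "c * x powr (2 * s)"]
      by (simp only: mult.left_commute[of "(1 - 2 * s) / x"])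
  qed
  have V_cont: "continuous_on ({0..} \<times> UNIV) (\<lambda>(x, t). V x t)"
    unfolding V_def using s(1) cont \<phi> by (rule poisson_extension_continuous)
  have V0: "V 0 t = \<phi> t" for t using s by (simp add: V_def poisson_extension_0)
  have V_bdd: "\<bar>V x t\<bar> \<le> M" for x t
    unfolding V_def using s(1) meas \<phi> by (rule poisson_extension_bound)
  have "U x t - V x t \<le> 0"
  proof (rule bounded_ancient_solution_nonpos[OF s, where W="\<lambda>x t. U x t - V x t" and Wx="\<lambda>x t. Ux x t - Vx x t"
      and Wxx="\<lambda>x t. Uxx x t - Vxx x t" and Wt="\<lambda>x t. Ut x t - Vt x t" and M="N + M"])
    show "continuous_on ({0..} \<times> UNIV) (\<lambda>(x, t). U x t - V x t)"
      using continuous_on_diff[OF U_cont V_cont] by (simp add: case_prod_unfold)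
    show "Ut x t - Vt x t = (1 - 2 * s) / x * (Ux x t - Vx x t) + (Uxx x t - Vxx x t)" if "0 < x" for x t
      unfolding right_diff_distrib using U_derivs(4)[OF that] V_pde[OF that] by simp
    show "U x t - V x t \<le> N + M" if "0 \<le> x" for x t using bdd[OF that, of t] V_bdd[of x t] by simp
  qed (auto intro!: DERIV_diff U_derivs V_derivs x simp: U0 V0)
  moreover have "V x t - U x t \<le> 0"
  proof (rule bounded_ancient_solution_nonpos[OF s, where W="\<lambda>x t. V x t - U x t" and Wx="\<lambda>x t. Vx x t - Ux x t"
      and Wxx="\<lambda>x t. Vxx x t - Uxx x t" and Wt="\<lambda>x t. Vt x t - Ut x t" and M="N + M"])
    show "continuous_on ({0..} \<times> UNIV) (\<lambda>(x, t). V x t - U x t)"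
      using continuous_on_diff[OF V_cont U_cont] by (simp add: case_prod_unfold)
    show "Vt x t - Ut x t = (1 - 2 * s) / x * (Vx x t - Ux x t) + (Vxx x t - Uxx x t)" if "0 < x" for x t
      unfolding right_diff_distrib using U_derivs(4)[OF that] V_pde[OF that] by simp
    show "V x t - U x t \<le> N + M" if "0 \<le> x" for x t using bdd[OF that, of t] V_bdd[of x t] by simp
  qed (auto intro!: DERIV_diff U_derivs V_derivs x simp: U0 V0)
  ultimately show ?thesis by (simp add: V_def)
qed

section \<open>The Marchaud derivative as a boundary limit\<close>

lemma set_integrable_lborel_nonneg:
  fixes f :: "real \<Rightarrow> real"
  assumes "f integrable_on S" "\<And>x. x \<in> S \<Longrightarrow> 0 \<le> f x" "f \<in> borel_measurable borel" "S \<in> sets borel"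
  shows "set_integrable lborel S f"
proof -
  have "integrable lebesgue (\<lambda>x. indicator S x *\<^sub>R f x)"
    using nonnegative_absolutely_integrable_1[OF assms(1,2)] by (simp add: set_integrable_def)
  then show ?thesis unfolding set_integrable_def
    using assms(3,4) by (subst (asm) integrable_completion) auto
qed

text \<open>On \<open>(0, 1]\<close> the Hoelder bound on \<open>[t - 1, t]\<close> gives
  \<open>C * \<tau> powr (\<gamma> - s - 1)\<close>, integrable since \<open>s < \<gamma>\<close>;
  beyond 1, boundedness gives \<open>2 * M * \<tau> powr (- s - 1)\<close>, integrable since
  \<open>0 < s\<close>.\<close>

lemma marchaud_integrand_integrable:
  assumes s: "0 < s" "s < \<gamma>" and cont: "continuous_on UNIV \<phi>" and \<phi>: "\<And>r. \<bar>\<phi> r\<bar> \<le> M"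
    and hoelder: "locally_hoelder \<gamma> \<phi>"
  shows "set_integrable lborel {0<..} (marchaud_integrand s \<phi> t)"
proof -
  have [measurable]: "\<phi> \<in> borel_measurable borel" using cont by (rule borel_measurable_continuous_onI)
  have M: "0 \<le> M" using \<phi>[of 0] by simp
  obtain C where C: "\<And>x y. x \<in> {t - 1..t} \<Longrightarrow> y \<in> {t - 1..t} \<Longrightarrow> \<bar>\<phi> x - \<phi> y\<bar> \<le> C * \<bar>x - y\<bar> powr \<gamma>"
    using hoelder unfolding locally_hoelder_def by (meson compact_Icc)
  have 1: "set_integrable lborel {0..1} (\<lambda>\<tau>. \<tau> powr (\<gamma> - s - 1))"
    using integrable_on_powr_from_0[of "\<gamma> - s - 1" 1] s by (intro set_integrable_lborel_nonneg) auto
  have 2: "set_integrable lborel {1..} (\<lambda>\<tau>. \<tau> powr (- s - 1))"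
    using has_integral_powr_to_inf[of "- s - 1" 1] s
    by (intro set_integrable_lborel_nonneg) (auto simp: integrable_on_def)
  define w where "w = (\<lambda>\<tau>. C * (indicator {0..1} \<tau> *\<^sub>R \<tau> powr (\<gamma> - s - 1))
    + 2 * M * (indicator {1..} \<tau> *\<^sub>R \<tau> powr (- s - 1)))"
  have w: "integrable lborel w"
    using 1 2 unfolding w_def set_integrable_def
    by (intro Bochner_Integration.integrable_add integrable_mult_right) auto
  show ?thesis unfolding set_integrable_def
  proof (rule Bochner_Integration.integrable_bound[OF w])
    show "(\<lambda>\<tau>. indicator {0<..} \<tau> *\<^sub>R marchaud_integrand s \<phi> t \<tau>) \<in> borel_measurable lborel"
      unfolding marchaud_integrand_def by measurable
    show "AE \<tau> in lborel. norm (indicator {0<..} \<tau> *\<^sub>R marchaud_integrand s \<phi> t \<tau>) \<le> norm (w \<tau>)"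
    proof (rule AE_I2)
      fix \<tau>
      have C0: "0 \<le> C" using C[of t "t - 1"] by simp
      have "\<bar>marchaud_integrand s \<phi> t \<tau>\<bar> \<le> w \<tau>" if "0 < \<tau>"
      proof (cases "\<tau> \<le> 1")
        case True
        have "\<bar>\<phi> t - \<phi> (t - \<tau>)\<bar> / \<tau> powr (s + 1) \<le> C * \<tau> powr \<gamma> / \<tau> powr (s + 1)"
          using C[of t "t - \<tau>"] True that by (intro divide_right_mono) auto
        also have "\<dots> = C * \<tau> powr (\<gamma> - s - 1)" by (simp add: diff_diff_eq powr_diff)
        \<comment> \<open>An inequality, because at \<open>\<tau> = 1\<close> both indicators are 1
          and the second term of \<open>w\<close> is added.\<close>
        also have "\<dots> \<le> w \<tau>" using True that M by (simp add: w_def)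
        finally show ?thesis by (simp add: marchaud_integrand_def)
      next
        case False
        have "\<bar>\<phi> t - \<phi> (t - \<tau>)\<bar> / \<tau> powr (s + 1) \<le> 2 * M / \<tau> powr (s + 1)"
          using \<phi>[of t] \<phi>[of "t - \<tau>"] by (intro divide_right_mono) auto
        also have "\<dots> = 2 * M * \<tau> powr (- s - 1)"
          using powr_minus[of \<tau> "s + 1"] by (simp add: divide_inverse)
        also have "\<dots> = w \<tau>" using False by (simp add: w_def)
        finally show ?thesis by (simp add: marchaud_integrand_def)
      qed
      then show "norm (indicator {0<..} \<tau> *\<^sub>R marchaud_integrand s \<phi> t \<tau>) \<le> norm (w \<tau>)"
        by (auto simp: indicator_def)
    qed
  qed
qed

text \<open>Applying the kernel form to the constant function 1 shows that the weight has mass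
  \<open>4 powr s * Gamma s * x powr (- 2 * s)\<close>. Hence \<open>\<phi> t\<close> times this
  factor is an integral against the same weight, and the two integrals merge.\<close>

lemma poisson_extension_difference_quotient:
  assumes s: "0 < s" and x: "0 < x" and [measurable]: "\<phi> \<in> borel_measurable borel" and \<phi>: "\<And>r. \<bar>\<phi> r\<bar> \<le> M"
  shows "- (4 powr s * Gamma s * x powr (- 2 * s) * (poisson_extension s \<phi> x t - \<phi> t))
    = (\<integral>\<tau>. inverse_gamma_weight (x\<^sup>2 / 4) s \<tau> * (\<phi> t - \<phi> (t - \<tau>)) \<partial>lborel)"
proof -
  have q: "0 < x\<^sup>2 / 4" using x by simp
  have 1: "integrable lborel (\<lambda>\<tau>. inverse_gamma_weight (x\<^sup>2 / 4) s \<tau> * \<phi> (t - \<tau>))"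
    using integrable_inverse_gamma_weight[OF q s] \<phi> by (intro integrable_mult_bounded) auto
  have 2: "integrable lborel (\<lambda>\<tau>. inverse_gamma_weight (x\<^sup>2 / 4) s \<tau> * \<phi> t)"
    using integrable_inverse_gamma_weight[OF q s] by simp
  have one: "poisson_extension s (\<lambda>_. 1) x t = 1"
    using has_bochner_integral_integral_eq[OF has_bochner_integral_gamma_weight[OF s]] Gamma_real_pos[OF s]
    by (simp add: poisson_extension_def)
  have eq: "poisson_extension s \<psi> x t * (4 powr s * Gamma s * x powr (- 2 * s))
      = (\<integral>\<tau>. inverse_gamma_weight (x\<^sup>2 / 4) s \<tau> * \<psi> (t - \<tau>) \<partial>lborel)"
    if "\<psi> \<in> borel_measurable borel" "\<And>r. \<bar>\<psi> r\<bar> \<le> N" for \<psi> N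
    using poisson_extension_conv_potential[OF s x that, of t] x Gamma_real_pos[OF s]
    by (simp add: powr_minus potential_def)
  have "(\<integral>\<tau>. inverse_gamma_weight (x\<^sup>2 / 4) s \<tau> * (\<phi> t - \<phi> (t - \<tau>)) \<partial>lborel)
      = (\<integral>\<tau>. inverse_gamma_weight (x\<^sup>2 / 4) s \<tau> * 1 \<partial>lborel) * \<phi> t
        - (\<integral>\<tau>. inverse_gamma_weight (x\<^sup>2 / 4) s \<tau> * \<phi> (t - \<tau>) \<partial>lborel)"
    unfolding right_diff_distrib using 1 2 by (subst Bochner_Integration.integral_diff) auto
  also have "\<dots> = 4 powr s * Gamma s * x powr (- 2 * s) * \<phi> t
      - poisson_extension s \<phi> x t * (4 powr s * Gamma s * x powr (- 2 * s))"
    using eq[of "\<lambda>_. 1" 1] unfolding eq[OF assms(3) \<phi>] one by simp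
  finally show ?thesis by (simp add: algebra_simps)
qed

lemma marchaud_deriv_limit:
  assumes int: "set_integrable lborel {0<..} (marchaud_integrand s \<phi> t)"
    and [measurable]: "\<phi> \<in> borel_measurable borel"
  shows "((\<lambda>x. \<integral>\<tau>. inverse_gamma_weight (x\<^sup>2 / 4) s \<tau> * (\<phi> t - \<phi> (t - \<tau>)) \<partial>lborel)
    \<longlongrightarrow> marchaud_deriv s \<phi> t) (at_right 0)"
  unfolding tendsto_at_iff_sequentially comp_def
proof (intro allI impI)
  fix X :: "nat \<Rightarrow> real" assume X: "\<forall>i. X i \<in> {0<..} - {0}" "X \<longlonglongrightarrow> 0"
  let ?m = "\<lambda>\<tau>. indicator {0<..} \<tau> *\<^sub>R marchaud_integrand s \<phi> t \<tau>"
  \<comment> \<open>For \<open>\<tau> \<le> 0\<close> the weight and the indicator both vanish. The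
    remaining exponential factor lies between 0 and 1 for positive \<open>\<tau>\<close>, so the
    Marchaud integrand dominates.\<close>
  have eq: "inverse_gamma_weight q s \<tau> * (\<phi> t - \<phi> (t - \<tau>)) = exp (- q / \<tau>) * ?m \<tau>" for q \<tau>
    using powr_minus[of \<tau> "s + 1"]
    by (simp add: inverse_gamma_weight_def marchaud_integrand_def divide_inverse indicator_def)
  have "(\<lambda>n. \<integral>\<tau>. exp (- ((X n)\<^sup>2 / 4) / \<tau>) * ?m \<tau> \<partial>lborel) \<longlonglongrightarrow> (\<integral>\<tau>. ?m \<tau> \<partial>lborel)"
  proof (rule integral_dominated_convergence[where w="\<lambda>\<tau>. norm (?m \<tau>)"])
    show "integrable lborel (\<lambda>\<tau>. norm (?m \<tau>))"
      using int unfolding set_integrable_def by (rule integrable_norm)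
    show m: "?m \<in> borel_measurable lborel" using int unfolding set_integrable_def by auto
    show "(\<lambda>\<tau>. exp (- ((X n)\<^sup>2 / 4) / \<tau>) * ?m \<tau>) \<in> borel_measurable lborel" for n
      by (rule borel_measurable_times[OF _ m]) measurable
    show "AE \<tau> in lborel. (\<lambda>n. exp (- ((X n)\<^sup>2 / 4) / \<tau>) * ?m \<tau>) \<longlonglongrightarrow> ?m \<tau>"
    proof (rule AE_I2)
      fix \<tau>
      have "(\<lambda>n. exp (- ((X n)\<^sup>2 / 4) / \<tau>) * ?m \<tau>) \<longlonglongrightarrow> exp (- (0\<^sup>2 / 4) / \<tau>) * ?m \<tau>" if "\<tau> \<noteq> 0"
        using X(2) that by (intro tendsto_intros) auto
      then show "(\<lambda>n. exp (- ((X n)\<^sup>2 / 4) / \<tau>) * ?m \<tau>) \<longlonglongrightarrow> ?m \<tau>"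
        by (cases "\<tau> = 0") auto
    qed
    show "AE \<tau> in lborel. norm (exp (- ((X n)\<^sup>2 / 4) / \<tau>) * ?m \<tau>) \<le> norm (?m \<tau>)" for n
    proof (rule AE_I2)
      fix \<tau>
      have "exp (- ((X n)\<^sup>2 / 4) / \<tau>) \<le> 1" if "0 < \<tau>" using that by simp
      then show "norm (exp (- ((X n)\<^sup>2 / 4) / \<tau>) * ?m \<tau>) \<le> norm (?m \<tau>)"
        by (cases "0 < \<tau>") (auto simp: abs_mult intro: mult_left_le_one_le)
    qed
  qed
  then show "(\<lambda>n. \<integral>\<tau>. inverse_gamma_weight ((X n)\<^sup>2 / 4) s \<tau> * (\<phi> t - \<phi> (t - \<tau>)) \<partial>lborel) \<longlonglongrightarrow> marchaud_deriv s \<phi> t"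
    unfolding eq marchaud_deriv_def set_lebesgue_integral_def .
qed

text \<open>Boundedness of \<open>U\<close> selects the solution. For \<open>s < 1/2\<close> and
  zero boundary data, \<open>exp (- t)\<close> times \<open>x powr s\<close> times the Bessel
  function of order \<open>s\<close> at \<open>x\<close> is an unbounded solution that tends to 0 as
  \<open>x\<close> grows, yet divided by \<open>x powr (2 * s)\<close> it has a nonzero limit at
  \<open>x = 0\<close>.\<close>

theorem theorem1p1:
  fixes s \<gamma> :: real and \<phi> :: "real \<Rightarrow> real" and U :: "real \<Rightarrow> real \<Rightarrow> real"
  assumes "0 < s" and "s < 1"
    and "s < \<gamma>" and "\<gamma> \<le> 1"
    and "bounded (range \<phi>)"
    and "locally_hoelder \<gamma> \<phi>"
    and "extension_solution s \<phi> U"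
    and "bounded ((\<lambda>(x, t). U x t) ` ({0..} \<times> UNIV))"
  shows "defines_extension_operator s \<phi> U"
proof -
  have U0: "U 0 t = \<phi> t" for t
    using assms(7) by (simp add: extension_solution_def)
  \<comment> \<open>Continuity of \<open>\<phi>\<close> is read off from \<open>U\<close>, which is
    continuous up to the line \<open>x = 0\<close>.\<close>
  have "continuous_on UNIV (\<lambda>t. (\<lambda>(x, t). U x t) (0, t))"
    using assms(7) unfolding extension_solution_def
    by (intro continuous_on_compose2[where f="\<lambda>t. (0, t)" and g="\<lambda>(x, t). U x t"] continuous_intros) auto
  then have cont: "continuous_on UNIV \<phi>" by (simp add: U0)
  have meas: "\<phi> \<in> borel_measurable borel" using cont by (rule borel_measurable_continuous_onI)
  obtain M where M: "\<And>r. \<bar>\<phi> r\<bar> \<le> M" using assms(5) unfolding bounded_iff by auto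
  obtain N where N: "\<And>x t. 0 \<le> x \<Longrightarrow> \<bar>U x t\<bar> \<le> N" using assms(8) unfolding bounded_iff by fastforce
  have int: "set_integrable lborel {0<..} (marchaud_integrand s \<phi> t)" for t
    using assms(1,3) cont M assms(6) by (rule marchaud_integrand_integrable)
  have "((\<lambda>x. - (4 powr s * Gamma s * x powr (- 2 * s) * (U x t - \<phi> t))) \<longlongrightarrow> marchaud_deriv s \<phi> t) (at_right 0)" for t
  proof (rule Lim_transform_eventually[OF marchaud_deriv_limit[OF int meas]])
    show "\<forall>\<^sub>F x in at_right 0. (\<integral>\<tau>. inverse_gamma_weight (x\<^sup>2 / 4) s \<tau> * (\<phi> t - \<phi> (t - \<tau>)) \<partial>lborel)
        = - (4 powr s * Gamma s * x powr (- 2 * s) * (U x t - \<phi> t))"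
      using eventually_at_right_less
    proof eventually_elim
      case (elim x)
      then show ?case
        using poisson_extension_difference_quotient[OF assms(1) elim meas M]
          bounded_extension_solution_unique[OF assms(1,2) cont M assms(7) N elim] by simp
    qed
  qed
  then show ?thesis using U0 int by (simp add: defines_extension_operator_def)
qed

end
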